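(* Let $\{x,y\}$ be a true pair in a graph $G$. Then $\operatorname{reg}(G)=\operatorname{reg}(\mathfrak{g}(G;xy))$.
   Context: $\operatorname{reg}(G)=\max\{j\ge0:\widetilde H_{j-1}(\operatorname{Ind}(G[S]);\Bbbk)\neq0\text{ for some }S\subseteq V(G)\}$ over a field $\Bbbk$, $\operatorname{Ind}$ the independence complex. A genuine pair in $G$ is a pair of distinct non-adjacent vertices $x,y$ such that there are no vertices $u,v\in V(G)\setminus\{x,y\}$ with $G[\{x,y,u,v\}]$ isomorphic to $2K_2$ (two disjoint edges). For a genuine pair, $\mathfrak{g}(G;xy)$ is the graph obtained from $G-\{x,y\}$ by adding a new vertex $w$ adjacent exactly to the vertices of $N_G(x)\cap N_G(y)$. A genuine pair $\{x,y\}$ is a true pair if there is a vertex $u\in N_G(x)\cap N_G(y)$ with $N_G[u]\subseteq N_G[x]\cup N_G[y]$. *)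

theory Defs
  imports Main
begin

type_synonym 'a graph = "'a set \<times> 'a set set"

definition verts :: "'a graph \<Rightarrow> 'a set" where "verts G = fst G"
definition edges :: "'a graph \<Rightarrow> 'a set set" where "edges G = snd G"

definition is_graph :: "'a graph \<Rightarrow> bool" where
  "is_graph G \<longleftrightarrow> finite (verts G) \<and>
     (\<forall>e\<in>edges G. \<exists>u v. e = {u, v} \<and> u \<noteq> v \<and> u \<in> verts G \<and> v \<in> verts G)"

definition adj :: "'a graph \<Rightarrow> 'a \<Rightarrow> 'a \<Rightarrow> bool" where
  "adj G u v \<longleftrightarrow> {u, v} \<in> edges G"

definition nbhd :: "'a graph \<Rightarrow> 'a \<Rightarrow> 'a set" where
  "nbhd G x = {u \<in> verts G. adj G x u}"

definition cnbhd :: "'a graph \<Rightarrow> 'a \<Rightarrow> 'a set" where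
  "cnbhd G x = insert x (nbhd G x)"

definition induces_2K2 :: "'a graph \<Rightarrow> 'a set \<Rightarrow> bool" where
  "induces_2K2 G A \<longleftrightarrow> A \<subseteq> verts G \<and> card A = 4 \<and>
     (\<exists>a b c d. A = {a, b, c, d} \<and> {e \<in> edges G. e \<subseteq> A} = {{a, b}, {c, d}})"

definition genuine_pair :: "'a graph \<Rightarrow> 'a \<Rightarrow> 'a \<Rightarrow> bool" where
  "genuine_pair G x y \<longleftrightarrow> x \<in> verts G \<and> y \<in> verts G \<and> x \<noteq> y \<and> \<not> adj G x y \<and>
     \<not> (\<exists>u v. u \<in> verts G - {x, y} \<and> v \<in> verts G - {x, y} \<and> induces_2K2 G {x, y, u, v})"

definition true_pair :: "'a graph \<Rightarrow> 'a \<Rightarrow> 'a \<Rightarrow> bool" where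
  "true_pair G x y \<longleftrightarrow> genuine_pair G x y \<and>
     (\<exists>u \<in> nbhd G x \<inter> nbhd G y. cnbhd G u \<subseteq> cnbhd G x \<union> cnbhd G y)"

text \<open>g(G;xy): delete x and y, add a new vertex w (any vertex not in V - {x,y})
adjacent exactly to the common neighbours of x and y.\<close>
definition gpair :: "'a graph \<Rightarrow> 'a \<Rightarrow> 'a \<Rightarrow> 'a \<Rightarrow> 'a graph" where
  "gpair G x y w =
     (insert w (verts G - {x, y}),
      {e \<in> edges G. x \<notin> e \<and> y \<notin> e} \<union> {{w, u} | u. u \<in> nbhd G x \<inter> nbhd G y})"

definition indep :: "'a graph \<Rightarrow> 'a set \<Rightarrow> bool" where
  "indep G F \<longleftrightarrow> (\<forall>u\<in>F. \<forall>v\<in>F. \<not> adj G u v)"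

definition Ind :: "'a graph \<Rightarrow> 'a set \<Rightarrow> 'a set set" where
  "Ind G S = {F. F \<subseteq> S \<and> indep G F}"

text \<open>Augmented oriented simplicial chain complex of a finite complex K (a set of faces),
indexed by face cardinality m (so cardinality m corresponds to dimension m-1, and
m = 0 is the augmentation degree -1). Simplices are oriented by the linear order of
vertices. A chain of cardinality m is a coefficient function supported on faces of
cardinality m.\<close>

definition is_chain :: "'a set set \<Rightarrow> nat \<Rightarrow> ('a set \<Rightarrow> 'k::field) \<Rightarrow> bool" where
  "is_chain K m c \<longleftrightarrow> (\<forall>\<sigma>. c \<sigma> \<noteq> 0 \<longrightarrow> \<sigma> \<in> K \<and> card \<sigma> = m)"

definition bdry :: "'a::linorder set set \<Rightarrow> ('a set \<Rightarrow> 'k::field) \<Rightarrow> ('a set \<Rightarrow> 'k)" where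
  "bdry K c = (\<lambda>\<tau>. if \<tau> \<in> K then
      (\<Sum>\<sigma> \<in> {\<sigma> \<in> K. \<tau> \<subset> \<sigma> \<and> card \<sigma> = Suc (card \<tau>)}.
          (- 1) ^ card {v \<in> \<tau>. v < the_elem (\<sigma> - \<tau>)} * c \<sigma>)
     else 0)"

text \<open>redhom_nonzero K j  iff  reduced homology group H~_{j-1}(K; k) is nonzero,
i.e. there is a (j-1)-cycle which is not a boundary.\<close>
definition redhom_nonzero :: "'k::field itself \<Rightarrow> 'a::linorder set set \<Rightarrow> nat \<Rightarrow> bool" where
  "redhom_nonzero T K j \<longleftrightarrow>
     (\<exists>c :: 'a set \<Rightarrow> 'k. is_chain K j c \<and> bdry K c = (\<lambda>_. 0) \<and>
        \<not> (\<exists>b :: 'a set \<Rightarrow> 'k. is_chain K (Suc j) b \<and> bdry K b = c))"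

text \<open>Castelnuovo-Mumford regularity via Hochster's formula, as in the paper.\<close>
definition reg :: "'k::field itself \<Rightarrow> 'a::linorder graph \<Rightarrow> nat" where
  "reg T G = Max {j. \<exists>S \<subseteq> verts G. redhom_nonzero T (Ind G S) j}"

end

theory Submission
  imports Defs "HOL-Library.Function_Algebras"
begin

text \<open>
  The two graphs even have the same set of degrees in which some induced subgraph has homology.
  The simplicial map \<open>x, y \<mapsto> w\<close> contracts the edge \<open>xy\<close> of \<open>Ind(G[S \<union> {x, y}])\<close>; genuineness
  says exactly that the result is again an independence complex, that of \<open>S \<union> {w}\<close> in
  \<open>g(G;xy)\<close>, and contraction preserves homology. It remains to treat sets \<open>S\<close> containing \<open>x\<close>
  but not \<open>y\<close>. By the exact sequence of \<open>y\<close>, homology of \<open>S\<close> survives in \<open>S \<union> {y}\<close>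
  or comes from \<open>T = S - N[y]\<close>; by that of \<open>x\<close>, homology of \<open>T\<close> survives in \<open>T - {x}\<close> or
  comes, one degree lower, from \<open>T - N[x]\<close>. The last set avoids both closed neighbourhoods, hence
  also \<open>N[u]\<close> for the vertex \<open>u\<close> given by trueness, so adding the isolated edge \<open>wu\<close> suspends
  its complex and restores the degree.
\<close>

section \<open>Wedging with a vertex\<close>

text \<open>The sign of moving \<open>v\<close> past the smaller vertices of
  \<open>\<sigma>\<close>. The comparison is strict, so the sign is the same whether or not
  \<open>v\<close> lies in \<open>\<sigma>\<close>.\<close>

definition sgn_at :: "'a::linorder \<Rightarrow> 'a set \<Rightarrow> 'k::field" where
  "sgn_at v \<sigma> = (- 1) ^ card {u \<in> \<sigma>. u < v}"

text \<open>Left multiplication by \<open>v\<close> in the exterior algebra on the vertices; a set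
  stands for the product of its elements in increasing order.\<close>

definition wedge :: "'a::linorder \<Rightarrow> ('a set \<Rightarrow> 'k::field) \<Rightarrow> 'a set \<Rightarrow> 'k" where
  "wedge v c = (\<lambda>\<sigma>. if v \<in> \<sigma> then sgn_at v \<sigma> * c (\<sigma> - {v}) else 0)"

definition avoids :: "'a \<Rightarrow> ('a set \<Rightarrow> 'k::zero) \<Rightarrow> bool" where
  "avoids v c \<longleftrightarrow> (\<forall>\<sigma>. v \<in> \<sigma> \<longrightarrow> c \<sigma> = 0)"

lemma sgn_at_square [simp]: "sgn_at v \<sigma> * sgn_at v \<sigma> = (1 :: 'k::field)"
  by (simp add: sgn_at_def flip: power_add mult_2)

lemma sgn_at_square_left [simp]: "sgn_at v \<sigma> * (sgn_at v \<sigma> * a) = (a :: 'k::field)"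
  by (simp flip: mult.assoc)

lemma sgn_at_insert_self [simp]: "sgn_at v (insert v \<sigma>) = sgn_at v \<sigma>"
proof -
  have "{u \<in> insert v \<sigma>. u < v} = {u \<in> \<sigma>. u < v}" by auto
  then show ?thesis by (simp add: sgn_at_def)
qed

lemma sgn_at_insert:
  assumes "finite \<sigma>" "u \<notin> \<sigma>" "u \<noteq> v"
  shows "sgn_at v (insert u \<sigma>) = (if u < v then - sgn_at v \<sigma> else sgn_at v \<sigma> :: 'k::field)"
proof -
  have "{t \<in> insert u \<sigma>. t < v} = (if u < v then insert u {t \<in> \<sigma>. t < v} else {t \<in> \<sigma>. t < v})"
    by auto
  then show ?thesis using assms by (simp add: sgn_at_def)
qed

text \<open>Exactly one of \<open>u < v\<close> and \<open>v < u\<close> holds, so exactly one of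
  the two signs flips: anticommutativity of the exterior product.\<close>

lemma sgn_at_swap:
  assumes "finite \<sigma>" "u \<notin> \<sigma>" "v \<notin> \<sigma>" "u \<noteq> v"
  shows "sgn_at u (insert v \<sigma>) * sgn_at v (insert u \<sigma>) = - (sgn_at v \<sigma> * sgn_at u \<sigma> :: 'k::field)"
  using assms by (auto simp: sgn_at_insert mult.commute)

lemma wedge_insert: "v \<notin> \<sigma> \<Longrightarrow> wedge v c (insert v \<sigma>) = sgn_at v \<sigma> * c \<sigma>"
  by (simp add: wedge_def)

lemma wedge_zero [simp]: "wedge v 0 = 0"
  and wedge_add: "wedge v (c + d) = wedge v c + wedge v d"
  and wedge_diff: "wedge v (c - d) = wedge v c - wedge v d"
  and wedge_minus: "wedge v (- c) = - wedge v c"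
  by (auto simp: wedge_def fun_eq_iff algebra_simps)

lemma avoids_add: "avoids v c \<Longrightarrow> avoids v d \<Longrightarrow> avoids v (c + d :: 'a set \<Rightarrow> 'k::field)"
  and avoids_diff: "avoids v c \<Longrightarrow> avoids v d \<Longrightarrow> avoids v (c - d :: 'a set \<Rightarrow> 'k::field)"
  and avoids_minus: "avoids v c \<Longrightarrow> avoids v (- c :: 'a set \<Rightarrow> 'k::field)"
  and avoids_zero: "avoids v (0 :: 'a set \<Rightarrow> 'k::field)"
  by (auto simp: avoids_def)

lemma avoids_wedge: "avoids v c \<Longrightarrow> u \<noteq> v \<Longrightarrow> avoids v (wedge u c)"
  by (auto simp: avoids_def wedge_def)

text \<open>The first summand lives on sets without \<open>v\<close>, the second on sets with
  \<open>v\<close>. Later proofs use this to compare coefficients of \<open>v\<close> in an equation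
  of chains.\<close>

lemma decomposition_unique:
  assumes "a + wedge v b = a' + wedge v b'" "avoids v a" "avoids v a'" "avoids v b" "avoids v b'"
  shows "a = a'" "b = (b' :: 'a::linorder set \<Rightarrow> 'k::field)"
proof -
  have eq: "a \<sigma> + wedge v b \<sigma> = a' \<sigma> + wedge v b' \<sigma>" for \<sigma>
    using assms(1) by (metis plus_fun_apply)
  show "a = a'"
  proof
    fix \<sigma> show "a \<sigma> = a' \<sigma>"
      using eq[of \<sigma>] assms(2,3) by (cases "v \<in> \<sigma>") (auto simp: avoids_def wedge_def)
  qed
  show "b = b'"
  proof
    fix \<sigma> show "b \<sigma> = b' \<sigma>"
    proof (cases "v \<in> \<sigma>")
      case True then show ?thesis using assms(4,5) by (auto simp: avoids_def)
    next
      case False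
      have "sgn_at v \<sigma> * b \<sigma> = sgn_at v \<sigma> * b' \<sigma>"
        using eq[of "insert v \<sigma>"] assms(2,3) False by (simp add: avoids_def wedge_insert)
      then show ?thesis by (metis sgn_at_square_left)
    qed
  qed
qed

section \<open>Chains of a simplicial complex\<close>

text \<open>Degrees are integers, so that links, which lower the degree, need no case distinction
  at the bottom of the complex: a chain of negative degree is zero.\<close>

definition chain :: "'a set set \<Rightarrow> int \<Rightarrow> ('a set \<Rightarrow> 'k::field) \<Rightarrow> bool" where
  "chain K n c \<longleftrightarrow> (\<forall>\<sigma>. c \<sigma> \<noteq> 0 \<longrightarrow> \<sigma> \<in> K \<and> int (card \<sigma>) = n)"

definition deletion :: "'a \<Rightarrow> 'a set set \<Rightarrow> 'a set set" where
  "deletion v K = {\<sigma> \<in> K. v \<notin> \<sigma>}"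

definition link :: "'a \<Rightarrow> 'a set set \<Rightarrow> 'a set set" where
  "link v K = {\<sigma>. v \<notin> \<sigma> \<and> insert v \<sigma> \<in> K}"

lemma chain_add: "chain K n c \<Longrightarrow> chain K n d \<Longrightarrow> chain K n (c + d)"
  by (simp add: chain_def) (metis add_0)

lemma chain_minus: "chain K n c \<Longrightarrow> chain K n (- c)"
  by (simp add: chain_def)

lemma chain_diff: "chain K n c \<Longrightarrow> chain K n d \<Longrightarrow> chain K n (c - d)"
  using chain_add[of K n c "- d"] chain_minus[of K n d] by simp

lemma chain_weaken: "chain K n c \<Longrightarrow> K \<subseteq> L \<Longrightarrow> chain L n c"
  by (auto simp: chain_def)

lemma chain_Int: "chain K n c \<Longrightarrow> chain L n c \<Longrightarrow> chain (K \<inter> L) n c"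
  by (auto simp: chain_def)

text \<open>Common faces may go to either side; here they go to \<open>K\<close>. This is the
  surjectivity in a Mayer-Vietoris sequence.\<close>

lemma chain_Un_split:
  assumes "chain (K \<union> L) n c"
  obtains a b where "c = a + b" "chain K n a" "chain L n b"
proof
  let ?a = "\<lambda>\<sigma>. if \<sigma> \<in> K then c \<sigma> else 0" and ?b = "\<lambda>\<sigma>. if \<sigma> \<in> K then 0 else c \<sigma>"
  show "c = ?a + ?b" by (auto simp: fun_eq_iff)
  show "chain K n ?a" "chain L n ?b" using assms by (auto simp: chain_def split: if_splits)
qed

lemma avoids_chain: "chain K n c \<Longrightarrow> (\<And>\<sigma>. \<sigma> \<in> K \<Longrightarrow> v \<notin> \<sigma>) \<Longrightarrow> avoids v c"
  by (auto simp: chain_def avoids_def)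

lemma avoids_chain_deletion: "chain (deletion v K) n c \<Longrightarrow> avoids v c"
  by (rule avoids_chain) (auto simp: deletion_def)

lemma avoids_chain_link: "chain (link v K) n c \<Longrightarrow> avoids v c"
  by (rule avoids_chain) (auto simp: link_def)

locale vertex_set =
  fixes V :: "'a::linorder set"
  assumes finite_V: "finite V"
begin

definition simp_complex :: "'a set set \<Rightarrow> bool" where
  "simp_complex K \<longleftrightarrow> K \<subseteq> Pow V \<and> (\<forall>\<sigma>\<in>K. \<forall>\<tau>\<subseteq>\<sigma>. \<tau> \<in> K)"

text \<open>A chain vanishes off its complex, so all extensions of \<open>\<tau>\<close> within
  \<open>V\<close> can be summed. One boundary map thus serves all complexes, and chains of
  \<open>K\<close>, its links and its deletions can be mixed in one equation.\<close>

definition bd :: "('a set \<Rightarrow> 'k::field) \<Rightarrow> 'a set \<Rightarrow> 'k" where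
  "bd c = (\<lambda>\<tau>. \<Sum>v\<in>V - \<tau>. sgn_at v \<tau> * c (insert v \<tau>))"

definition nonzero_homology :: "'k::field itself \<Rightarrow> 'a set set \<Rightarrow> int \<Rightarrow> bool" where
  "nonzero_homology T K n \<longleftrightarrow> (\<exists>c :: 'a set \<Rightarrow> 'k. chain K n c \<and> bd c = 0 \<and>
     \<not> (\<exists>b :: 'a set \<Rightarrow> 'k. chain K (n + 1) b \<and> bd b = c))"

lemma homologyI:
  fixes c :: "'a set \<Rightarrow> 'k::field"
  assumes "chain K n c" "bd c = 0" "\<And>b. chain K (n + 1) b \<Longrightarrow> bd b = c \<Longrightarrow> False"
  shows "nonzero_homology TYPE('k) K n"
  using assms unfolding nonzero_homology_def by blast

lemma homologyE:
  assumes "nonzero_homology TYPE('k::field) K n"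
  obtains c :: "'a set \<Rightarrow> 'k::field" where "chain K n c" "bd c = 0"
    "\<nexists>b. chain K (n + 1) b \<and> bd b = c"
  using assms unfolding nonzero_homology_def by blast

lemma not_homologyE:
  fixes c :: "'a set \<Rightarrow> 'k::field"
  assumes "\<not> nonzero_homology TYPE('k) K n" "chain K n c" "bd c = 0"
  obtains b where "chain K (n + 1) b" "bd b = c"
  using assms unfolding nonzero_homology_def by blast

lemma simp_complexI:
  assumes "\<And>\<sigma>. \<sigma> \<in> K \<Longrightarrow> \<sigma> \<subseteq> V" "\<And>\<sigma> \<tau>. \<sigma> \<in> K \<Longrightarrow> \<tau> \<subseteq> \<sigma> \<Longrightarrow> \<tau> \<in> K"
  shows "simp_complex K"
  using assms by (simp add: simp_complex_def subset_iff)

lemma simp_complexD: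
  assumes "simp_complex K" "\<sigma> \<in> K"
  shows "\<sigma> \<subseteq> V" "\<tau> \<subseteq> \<sigma> \<Longrightarrow> \<tau> \<in> K"
  using assms by (auto simp: simp_complex_def)

lemma simp_complex_deletion: "simp_complex K \<Longrightarrow> simp_complex (deletion v K)"
  by (rule simp_complexI) (auto simp: deletion_def dest: simp_complexD)

lemma simp_complex_link: "simp_complex K \<Longrightarrow> simp_complex (link v K)"
  by (rule simp_complexI) (auto simp: link_def dest: simp_complexD(1) intro: simp_complexD(2))

lemma simp_complex_Int: "simp_complex K \<Longrightarrow> simp_complex L \<Longrightarrow> simp_complex (K \<inter> L)"
  by (rule simp_complexI) (auto dest: simp_complexD)

lemma simp_complex_finite: "simp_complex K \<Longrightarrow> \<sigma> \<in> K \<Longrightarrow> finite \<sigma>"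
  using finite_V finite_subset simp_complexD(1) by metis

lemma link_subset_deletion: "simp_complex K \<Longrightarrow> link v K \<subseteq> deletion v K"
  using simp_complexD(2)[of K _ _] by (force simp: link_def deletion_def)

lemma deletion_subset: "deletion v K \<subseteq> K"
  by (auto simp: deletion_def)

lemma bd_zero [simp]: "bd 0 = 0"
  and bd_add: "bd (c + d) = bd c + bd d"
  and bd_diff: "bd (c - d) = bd c - bd d"
  and bd_minus: "bd (- c) = - bd c"
  by (auto simp: bd_def fun_eq_iff algebra_simps sum.distrib sum_subtractf sum_negf)

lemma avoids_bd: "avoids v c \<Longrightarrow> avoids v (bd c)"
  by (auto simp: avoids_def bd_def)

text \<open>The Leibniz rule, with augmentation giving \<open>v\<close> boundary 1. At a set without
  \<open>v\<close> only the insertion of \<open>v\<close> contributes; at a set with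
  \<open>v\<close> every other insertion changes sign by anticommutativity.\<close>

lemma bd_wedge:
  fixes c :: "'a set \<Rightarrow> 'k::field"
  assumes "simp_complex K" "chain K n c" "v \<in> V"
  shows "bd (wedge v c) = c - wedge v (bd c)"
proof
  fix \<tau>
  have fin: "finite (V - \<tau>)" using finite_V by simp
  show "bd (wedge v c) \<tau> = (c - wedge v (bd c)) \<tau>"
  proof (cases "v \<in> \<tau>")
    case False
    have "bd (wedge v c) \<tau> = (\<Sum>u\<in>{v}. sgn_at u \<tau> * wedge v c (insert u \<tau>))"
      unfolding bd_def using fin False assms(3)
      by (intro sum.mono_neutral_right) (auto simp: wedge_def)
    then show ?thesis using False by (simp add: wedge_insert) (simp add: wedge_def)
  next
    case True
    then obtain \<rho> where \<rho>: "\<tau> = insert v \<rho>" "v \<notin> \<rho>" by (metis Set.set_insert)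
    have V: "V - \<rho> = insert v (V - \<tau>)" using \<rho> assms(3) by auto
    have swap: "sgn_at u \<tau> * wedge v c (insert u \<tau>)
        = - (sgn_at v \<rho> * (sgn_at u \<rho> * c (insert u \<rho>)))" if u: "u \<in> V - \<tau>" for u
    proof (cases "finite \<rho>")
      case True
      have "insert u \<tau> = insert v (insert u \<rho>)" using \<rho> by auto
      then have "sgn_at u \<tau> * wedge v c (insert u \<tau>)
          = sgn_at u (insert v \<rho>) * sgn_at v (insert u \<rho>) * c (insert u \<rho>)"
        using \<rho> u wedge_insert[of v "insert u \<rho>" c] by (auto simp: mult.assoc)
      also have "sgn_at u (insert v \<rho>) * sgn_at v (insert u \<rho>) = - (sgn_at v \<rho> * sgn_at u \<rho> :: 'k)"
        using \<rho> u by (intro sgn_at_swap[OF True]) auto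
      finally show ?thesis by (simp add: mult.assoc)
    next
      case False
      \<comment> \<open>\<open>\<tau>\<close> ranges over all sets, including infinite ones, which
        are never faces.\<close>
      have "c \<sigma> = 0" if "infinite \<sigma>" for \<sigma>
        using assms that simp_complex_finite by (auto simp: chain_def)
      then show ?thesis using False \<rho> u by (simp add: wedge_def)
    qed
    have "bd (wedge v c) \<tau> = - (sgn_at v \<rho> * (\<Sum>u\<in>V - \<tau>. sgn_at u \<rho> * c (insert u \<rho>)))"
      unfolding bd_def by (simp add: swap sum_negf sum_distrib_left)
    moreover have "bd c \<rho> = sgn_at v \<rho> * c \<tau> + (\<Sum>u\<in>V - \<tau>. sgn_at u \<rho> * c (insert u \<rho>))"
      unfolding bd_def V using fin True \<rho> by simp
    ultimately show ?thesis using \<rho> by (simp add: wedge_insert algebra_simps)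
  qed
qed

lemma chain_bd:
  assumes "simp_complex K" "chain K n c"
  shows "chain K (n - 1) (bd c)"
  unfolding chain_def
proof (intro allI impI)
  fix \<tau> assume "bd c \<tau> \<noteq> 0"
  then have "\<not> (\<forall>v\<in>V - \<tau>. sgn_at v \<tau> * c (insert v \<tau>) = 0)"
    unfolding bd_def by (blast intro: sum.neutral)
  then obtain v where v: "v \<in> V - \<tau>" "c (insert v \<tau>) \<noteq> 0" by auto
  then have K: "insert v \<tau> \<in> K" "int (card (insert v \<tau>)) = n"
    using assms by (auto simp: chain_def)
  then have "finite \<tau>" using simp_complex_finite[OF assms(1) K(1)] by simp
  then show "\<tau> \<in> K \<and> int (card \<tau>) = n - 1"
    using K v assms(1) unfolding simp_complex_def by auto
qed

lemma chain_wedge: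
  assumes "simp_complex K" "chain (link v K) (n - 1) b"
  shows "chain K n (wedge v b)"
  unfolding chain_def
proof (intro allI impI)
  fix \<sigma> assume "wedge v b \<sigma> \<noteq> 0"
  then have "v \<in> \<sigma>" "b (\<sigma> - {v}) \<noteq> 0" by (auto simp: wedge_def split: if_splits)
  then have \<sigma>: "\<sigma> \<in> K" "int (card (\<sigma> - {v})) = n - 1"
    using assms(2) by (auto simp: chain_def link_def insert_absorb)
  have "finite \<sigma>" using \<sigma> simp_complex_finite[OF assms(1)] by blast
  then have "card \<sigma> = Suc (card (\<sigma> - {v}))" using \<open>v \<in> \<sigma>\<close> by (metis card.remove)
  then show "\<sigma> \<in> K \<and> int (card \<sigma>) = n" using \<sigma> by simp
qed

lemma chain_split:
  fixes c :: "'a set \<Rightarrow> 'k::field"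
  assumes "simp_complex K" "chain K n c"
  obtains a b where "c = a + wedge v b" "chain (deletion v K) n a" "chain (link v K) (n - 1) b"
proof
  let ?a = "\<lambda>\<sigma>. if v \<in> \<sigma> then 0 else c \<sigma>"
  \<comment> \<open>The sign squares to 1, so it cancels the one introduced by
    \<open>wedge\<close>.\<close>
  let ?b = "\<lambda>\<sigma>. if v \<in> \<sigma> then 0 else sgn_at v \<sigma> * c (insert v \<sigma>)"
  show "c = ?a + wedge v ?b"
  proof
    fix \<sigma>
    show "c \<sigma> = (?a + wedge v ?b) \<sigma>"
    proof (cases "v \<in> \<sigma>")
      case True
      then obtain \<rho> where "\<sigma> = insert v \<rho>" "v \<notin> \<rho>" by (metis Set.set_insert)
      then show ?thesis by (simp add: wedge_insert)
    qed (simp add: wedge_def)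
  qed
  show "chain (deletion v K) n ?a" using assms by (auto simp: chain_def deletion_def)
  show "chain (link v K) (n - 1) ?b"
    unfolding chain_def
  proof (intro allI impI)
    fix \<sigma> assume "?b \<sigma> \<noteq> 0"
    then have "v \<notin> \<sigma>" "c (insert v \<sigma>) \<noteq> 0" by (auto split: if_splits)
    moreover from this have K: "insert v \<sigma> \<in> K" "int (card (insert v \<sigma>)) = n"
      using assms by (auto simp: chain_def)
    moreover have "finite \<sigma>" using simp_complex_finite[OF assms(1) K(1)] by simp
    ultimately show "\<sigma> \<in> link v K \<and> int (card \<sigma>) = n - 1" by (auto simp: link_def)
  qed
qed

text \<open>Splitting off one vertex replaces the pairwise cancellation of double sums: two uses of
  the Leibniz rule turn \<open>bd (bd (wedge v b))\<close> into
  \<open>bd b - bd b + wedge v (bd (bd b))\<close>, and deletion and link have one vertex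
  less.\<close>

lemma bd_bd:
  fixes c :: "'a set \<Rightarrow> 'k::field"
  assumes "simp_complex K" "chain K n c"
  shows "bd (bd c) = 0"
proof -
  \<comment> \<open>\<open>W\<close> carries the faces and shrinks during the induction;
    \<open>V\<close> stays the range of summation in \<open>bd\<close>.\<close>
  have "bd (bd c) = 0"
    if "finite W" "simp_complex K" "chain K n c" "K \<subseteq> Pow W" "W \<subseteq> V"
    for W K n and c :: "'a set \<Rightarrow> 'k"
    using that
  proof (induction W arbitrary: K n c rule: finite_induct)
    case empty
    then have "c (insert v \<tau>) = 0" for v \<tau> by (auto simp: chain_def)
    then have "bd c = 0" by (simp add: bd_def zero_fun_def)
    then show "bd (bd c) = 0" by simp
  next
    case (insert v W)
    then obtain a b where c: "c = a + wedge v b"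
      and a: "chain (deletion v K) n a" and b: "chain (link v K) (n - 1) b"
      by (meson chain_split)
    note del = simp_complex_deletion[OF insert.prems(1), of v]
      and lk = simp_complex_link[OF insert.prems(1), of v]
    have sub: "deletion v K \<subseteq> Pow W" "link v K \<subseteq> Pow W" "W \<subseteq> V" "v \<in> V"
      using insert.prems by (auto simp: deletion_def link_def)
    have "bd (bd a) = 0" "bd (bd b) = 0"
      using insert.IH[OF del a] insert.IH[OF lk b] sub by auto
    then show "bd (bd c) = 0"
      by (simp add: c bd_add bd_diff bd_wedge[OF lk b] bd_wedge[OF lk chain_bd[OF lk b]] sub)
  qed
  from this[OF finite_V assms] assms(1) show ?thesis by (auto simp: simp_complex_def)
qed

section \<open>Deletion, link and suspension\<close>

text \<open>Exactness of link, deletion, \<open>K\<close> in degree \<open>n\<close>. If a cycle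
  \<open>c\<close> of the deletion bounds \<open>a + wedge v b\<close> in \<open>K\<close>, then
  \<open>b\<close> is a cycle of the link with \<open>c = bd a + b\<close>; filling \<open>b\<close>
  in the link fills \<open>c\<close> in the deletion.\<close>

lemma homology_from_deletion:
  assumes "simp_complex K" "v \<in> V" "nonzero_homology TYPE('k::field) (deletion v K) n"
  shows "nonzero_homology TYPE('k) K n \<or> nonzero_homology TYPE('k) (link v K) n"
proof (rule ccontr)
  assume "\<not> ?thesis"
  then have neg: "\<not> nonzero_homology TYPE('k) K n" "\<not> nonzero_homology TYPE('k) (link v K) n" by auto
  obtain c :: "'a set \<Rightarrow> 'k" where c: "chain (deletion v K) n c" "bd c = 0"
    and nb: "\<nexists>b. chain (deletion v K) (n + 1) b \<and> bd b = c"
    by (rule homologyE[OF assms(3)])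
  obtain d where d: "chain K (n + 1) d" "bd d = c"
    by (rule not_homologyE[OF neg(1) chain_weaken[OF c(1) deletion_subset] c(2)])
  obtain a b where d_eq: "d = a + wedge v b"
    and a: "chain (deletion v K) (n + 1) a" and b: "chain (link v K) (n + 1 - 1) b"
    by (rule chain_split[OF assms(1) d(1), of v])
  have lk: "simp_complex (link v K)" using assms(1) by (rule simp_complex_link)
  have "(bd a + b) + wedge v (- bd b) = c + wedge v 0"
    using d(2) by (simp add: d_eq bd_add bd_wedge[OF lk b assms(2)] wedge_minus algebra_simps)
  from decomposition_unique[OF this] a b c(1) have *: "bd a + b = c" "- bd b = 0"
    by (auto simp: avoids_add avoids_bd avoids_minus avoids_zero avoids_chain_deletion
        avoids_chain_link)
  have "chain (link v K) n b" "bd b = 0" using b * by simp_all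
  then obtain b' where b': "chain (link v K) (n + 1) b'" "bd b' = b"
    by (rule not_homologyE[OF neg(2)])
  have "bd (a + b') = c" using * b' by (simp add: bd_add)
  moreover have "chain (deletion v K) (n + 1) (a + b')"
    by (intro chain_add a chain_weaken[OF b'(1) link_subset_deletion[OF assms(1)]])
  ultimately show False using nb by blast
qed

text \<open>Exactness of deletion, \<open>K\<close>, link, the last one degree lower. In a cycle
  \<open>a + wedge v b\<close> the part \<open>b\<close> is a cycle of the link. If
  \<open>b = bd b'\<close>, adding the boundary of \<open>wedge v b'\<close> moves the cycle to
  \<open>a + b'\<close> in the deletion.\<close>

lemma homology_into_deletion:
  assumes "simp_complex K" "v \<in> V" "nonzero_homology TYPE('k::field) K n"
  shows "nonzero_homology TYPE('k) (deletion v K) n \<or> nonzero_homology TYPE('k) (link v K) (n - 1)"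
proof (rule ccontr)
  assume "\<not> ?thesis"
  then have neg: "\<not> nonzero_homology TYPE('k) (deletion v K) n"
    "\<not> nonzero_homology TYPE('k) (link v K) (n - 1)" by auto
  obtain c :: "'a set \<Rightarrow> 'k" where c: "chain K n c" "bd c = 0"
    and nb: "\<nexists>b. chain K (n + 1) b \<and> bd b = c"
    by (rule homologyE[OF assms(3)])
  obtain a b where c_eq: "c = a + wedge v b"
    and a: "chain (deletion v K) n a" and b: "chain (link v K) (n - 1) b"
    by (rule chain_split[OF assms(1) c(1), of v])
  have lk: "simp_complex (link v K)" using assms(1) by (rule simp_complex_link)
  have "(bd a + b) + wedge v (- bd b) = 0 + wedge v 0"
    using c(2) by (simp add: c_eq bd_add bd_wedge[OF lk b assms(2)] wedge_minus algebra_simps)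
  from decomposition_unique[OF this] a b have ab: "bd a + b = 0" "bd b = 0"
    by (auto simp: avoids_add avoids_bd avoids_minus avoids_zero avoids_chain_deletion
        avoids_chain_link)
  obtain b' where "chain (link v K) (n - 1 + 1) b'" "bd b' = b"
    by (rule not_homologyE[OF neg(2) b ab(2)])
  then have b': "chain (link v K) n b'" "bd b' = b" by simp_all
  have "chain (deletion v K) n (a + b')"
    by (intro chain_add a chain_weaken[OF b'(1) link_subset_deletion[OF assms(1)]])
  moreover have "bd (a + b') = 0" using ab b' by (simp add: bd_add)
  ultimately obtain d where d: "chain (deletion v K) (n + 1) d" "bd d = a + b'"
    by (rule not_homologyE[OF neg(1)])
  have "chain K (n + 1) (wedge v b')" using chain_wedge[OF assms(1), of v "n + 1" b'] b' by simp
  then have "chain K (n + 1) (d - wedge v b')"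
    by (rule chain_diff[OF chain_weaken[OF d(1) deletion_subset]])
  moreover have "bd (d - wedge v b') = c"
    by (simp add: bd_diff bd_wedge[OF lk b'(1) assms(2)] d(2) b'(2) c_eq)
  ultimately show False using nb by blast
qed

text \<open>A cycle \<open>z\<close> in the link of \<open>p\<close> can be coned off from both
  \<open>p\<close> and \<open>q\<close>; the difference of the cones is a cycle.\<close>

lemma homology_suspension:
  assumes "simp_complex K" "p \<in> V" "q \<in> V" "p \<noteq> q"
    and sub: "link p K \<subseteq> link q K"
    and "nonzero_homology TYPE('k::field) (link p K) n"
  shows "nonzero_homology TYPE('k) K (n + 1)"
proof -
  obtain z :: "'a set \<Rightarrow> 'k" where z: "chain (link p K) n z" "bd z = 0"
    and nb: "\<nexists>b. chain (link p K) (n + 1) b \<and> bd b = z"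
    by (rule homologyE[OF assms(6)])
  have lk: "simp_complex (link p K)" using assms(1) by (rule simp_complex_link)
  have zq: "chain (link q K) n z" using chain_weaken[OF z(1) sub] .
  show ?thesis
  proof (rule homologyI)
    show "chain K (n + 1) (wedge p z - wedge q z)"
      using z zq by (intro chain_diff chain_wedge assms) simp_all
    show "bd (wedge p z - wedge q z) = 0"
      by (simp add: bd_diff bd_wedge[OF lk z(1)] assms z)
  next
    fix d assume d: "chain K (n + 1 + 1) d" "bd d = wedge p z - wedge q z"
    obtain a b where d_eq: "d = a + wedge p b"
      and a: "chain (deletion p K) (n + 1 + 1) a" and b: "chain (link p K) (n + 1 + 1 - 1) b"
      by (rule chain_split[OF assms(1) d(1), of p])
    have "(bd a + b) + wedge p (- bd b) = - wedge q z + wedge p z"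
      using d(2) by (simp add: d_eq bd_add bd_wedge[OF lk b assms(2)] wedge_minus algebra_simps)
    \<comment> \<open>The cone over \<open>q\<close> avoids \<open>p\<close>, so comparing
      coefficients of \<open>p\<close> leaves \<open>z\<close> alone and makes it a boundary within
      the link of \<open>p\<close>.\<close>
    from decomposition_unique(2)[OF this] a b z assms(4) have "- bd b = z"
      by (auto simp: avoids_add avoids_bd avoids_minus avoids_zero avoids_chain_deletion
          avoids_chain_link avoids_wedge)
    then have "bd (- b) = z" by (simp add: bd_minus)
    moreover have "chain (link p K) (n + 1) (- b)" using b by (simp add: chain_minus add.commute)
    ultimately show False using nb by blast
  qed
qed

section \<open>Contracting an edge\<close>

lemma link_deletion_commute: "x \<noteq> y \<Longrightarrow> link y (deletion x K) = deletion x (link y K)"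
  by (auto simp: link_def deletion_def)

text \<open>The hypotheses describe \<open>K'\<close> as the image of \<open>K\<close> under
  \<open>x, y \<mapsto> w\<close>, and \<open>lk_Int\<close> is the link condition for the edge. On
  chains, \<open>a + wedge x b + wedge y b' + wedge x (wedge y e)\<close> maps to
  \<open>a + wedge w (b + b')\<close>. Cycles and bounding chains are transferred explicitly both
  ways, terms in \<open>x\<close> and \<open>y\<close> together absorbing the ambiguity of splitting
  over \<open>Lx \<union> Ly\<close>.\<close>

lemma homology_edge_contraction:
  assumes K: "simp_complex K" and K': "simp_complex K'"
    and V: "x \<in> V" "y \<in> V" "w \<in> V" and "x \<noteq> y"
    and del: "deletion w K' = deletion y (deletion x K)"
    and lk: "link w K' = deletion y (link x K) \<union> deletion x (link y K)"
    and lk_Int: "link y (link x K) = deletion y (link x K) \<inter> deletion x (link y K)"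
  shows "nonzero_homology TYPE('k::field) K' n \<longleftrightarrow> nonzero_homology TYPE('k) K n"
proof -
  define Lx where "Lx = deletion y (link x K)"
  define Ly where "Ly = deletion x (link y K)"
  have cLx: "simp_complex Lx" and cLy: "simp_complex Ly" and clk: "simp_complex (link w K')"
    unfolding Lx_def Ly_def by (intro simp_complex_deletion simp_complex_link K K')+
  have cxy: "simp_complex (Lx \<inter> Ly)" using cLx cLy by (rule simp_complex_Int)
  have lkxy: "link y (link x K) = Lx \<inter> Ly" and lkw: "link w K' = Lx \<union> Ly"
    using lk lk_Int by (auto simp: Lx_def Ly_def)
  have sub: "Lx \<subseteq> link x K" "Ly \<subseteq> link y K" by (auto simp: Lx_def Ly_def deletion_def)
  have av: "avoids x c" "avoids y c" if "chain (Lx \<union> Ly) m c" for m and c :: "'a set \<Rightarrow> 'k"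
    by (rule avoids_chain[OF that]; auto simp: Lx_def Ly_def deletion_def link_def)+
  have avx: "avoids x c" "avoids y c" if "chain Lx m c" for m and c :: "'a set \<Rightarrow> 'k"
    using av[of m c] chain_weaken[OF that, of "Lx \<union> Ly"] by auto
  have avy: "avoids x c" "avoids y c" if "chain Ly m c" for m and c :: "'a set \<Rightarrow> 'k"
    using av[of m c] chain_weaken[OF that, of "Lx \<union> Ly"] by auto
  have avD: "avoids x c" "avoids y c" "avoids w c" if "chain (deletion w K') m c"
    for m and c :: "'a set \<Rightarrow> 'k"
    by (rule avoids_chain[OF that], simp only: del, simp add: deletion_def,
        rule avoids_chain[OF that], simp only: del, simp add: deletion_def,
        rule avoids_chain[OF that], simp add: deletion_def)
  have Dsub: "deletion w K' \<subseteq> K" unfolding del by (auto simp: deletion_def)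
  have wx: "chain K m (wedge x c)" if "chain Lx (m - 1) c" for m and c :: "'a set \<Rightarrow> 'k"
    using that sub by (intro chain_wedge[OF K]) (rule chain_weaken)
  have wy: "chain K m (wedge y c)" if "chain Ly (m - 1) c" for m and c :: "'a set \<Rightarrow> 'k"
    using that sub by (intro chain_wedge[OF K]) (rule chain_weaken)
  have wxy: "chain K m (wedge x (wedge y c))" if "chain (Lx \<inter> Ly) (m - 1 - 1) c"
    for m and c :: "'a set \<Rightarrow> 'k"
    using that by (intro chain_wedge[OF K] chain_wedge[OF simp_complex_link[OF K]])
      (simp add: lkxy)
  have ww: "chain K' m (wedge w c)" if "chain (Lx \<union> Ly) (m - 1) c" for m and c :: "'a set \<Rightarrow> 'k"
    using that by (intro chain_wedge[OF K']) (simp add: lkw)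
  have bd_wxy: "bd (wedge x (wedge y e)) = wedge y e - wedge x e + wedge x (wedge y (bd e))"
    if "chain (Lx \<inter> Ly) m e" for m and e :: "'a set \<Rightarrow> 'k"
  proof -
    have "chain (link x K) (m + 1) (wedge y e)"
      using that by (intro chain_wedge[OF simp_complex_link[OF K]]) (simp add: lkxy)
    from bd_wedge[OF simp_complex_link[OF K] this V(1)] show ?thesis
      by (simp add: bd_wedge[OF cxy that V(2)] wedge_diff)
  qed
  text \<open>The basis of the exterior algebra on \<open>x\<close> and \<open>y\<close> splits every chain of \<open>K\<close> uniquely.\<close>
  have split: "\<exists>a b b' e. c = a + wedge x b + wedge y b' + wedge x (wedge y e) \<and>
      chain (deletion w K') m a \<and> chain Lx (m - 1) b \<and> chain Ly (m - 1) b' \<and>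
      chain (Lx \<inter> Ly) (m - 1 - 1) e" if cm: "chain K m c" for m and c :: "'a set \<Rightarrow> 'k"
  proof -
    obtain p q where pq: "c = p + wedge x q" "chain (deletion x K) m p" "chain (link x K) (m - 1) q"
      by (rule chain_split[OF K cm, of x])
    obtain a b' where p: "p = a + wedge y b'" "chain (deletion y (deletion x K)) m a"
      "chain (link y (deletion x K)) (m - 1) b'"
      by (rule chain_split[OF simp_complex_deletion[OF K] pq(2), of y])
    obtain b e where q: "q = b + wedge y e" "chain (deletion y (link x K)) (m - 1) b"
      "chain (link y (link x K)) (m - 1 - 1) e"
      by (rule chain_split[OF simp_complex_link[OF K] pq(3), of y])
    show ?thesis
      using pq p q assms(6)
      by (intro exI[of _ a] exI[of _ b] exI[of _ b'] exI[of _ e])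
        (simp add: del lkxy Lx_def Ly_def link_deletion_commute wedge_add)
  qed
  \<comment> \<open>Compare coefficients of \<open>x\<close> first, then coefficients of
    \<open>y\<close> in each of the two parts.\<close>
  have unique: "a = a' \<and> b = d \<and> b' = d' \<and> e = e'"
    if eq: "a + wedge x b + wedge y b' + wedge x (wedge y e)
          = a' + wedge x d + wedge y d' + wedge x (wedge y e')"
      and "avoids x a" "avoids y a" "avoids x a'" "avoids y a'"
        "avoids x b" "avoids y b" "avoids x d" "avoids y d"
        "avoids x b'" "avoids y b'" "avoids x d'" "avoids y d'"
        "avoids x e" "avoids y e" "avoids x e'" "avoids y e'"
    for a b b' e a' d d' e' :: "'a set \<Rightarrow> 'k"
  proof -
    have "(a + wedge y b') + wedge x (b + wedge y e) = (a' + wedge y d') + wedge x (d + wedge y e')"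
      using eq by (simp add: wedge_add algebra_simps)
    from decomposition_unique[OF this] that(2-) assms(6)
    have "a + wedge y b' = a' + wedge y d'" "b + wedge y e = d + wedge y e'"
      by (auto simp: avoids_add avoids_wedge)
    from this[THEN decomposition_unique(1)] this[THEN decomposition_unique(2)] that(2-)
    show ?thesis by auto
  qed
  \<comment> \<open>The boundary in these coordinates: one equation of chains becomes four, one for
    each basis element.\<close>
  have bd_split: "bd (a + wedge x b + wedge y b' + wedge x (wedge y e))
      = (bd a + b + b') + wedge x (- bd b - e) + wedge y (- bd b' + e) + wedge x (wedge y (bd e))"
    if "chain Lx m b" "chain Ly m b'" "chain (Lx \<inter> Ly) m' e"
    for m m' and a b b' e :: "'a set \<Rightarrow> 'k"
    by (simp add: bd_add bd_wedge[OF cLx that(1)] bd_wedge[OF cLy that(2)] bd_wxy[OF that(3)] V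
        wedge_diff wedge_add wedge_minus algebra_simps)
  have bd_w: "bd (a + wedge w b) = (bd a + b) + wedge w (- bd b)" if "chain (Lx \<union> Ly) m b"
    for m and a b :: "'a set \<Rightarrow> 'k"
    using bd_wedge[OF clk _ V(3), of m b] that by (simp add: lkw bd_add wedge_minus algebra_simps)
  have avw: "avoids w c" if "chain (Lx \<union> Ly) m c" for m and c :: "'a set \<Rightarrow> 'k"
    using that avoids_chain_link[of w K' m c] by (simp add: lkw)
  note chain_bds = chain_bd[OF cLx] chain_bd[OF cLy] chain_bd[OF cxy]
  note avs = av avx avy avD avw avoids_add avoids_diff avoids_minus avoids_bd avoids_zero
  have chain_Lxy: "chain Lx m c" "chain Ly m c" if "chain (Lx \<inter> Ly) m c" for m and c :: "'a set \<Rightarrow> 'k"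
    using chain_weaken[OF that] by auto
  have chain_LxLy: "chain (Lx \<union> Ly) m c" if "chain Lx m c \<or> chain Ly m c" for m and c :: "'a set \<Rightarrow> 'k"
    using that chain_weaken by blast
  show ?thesis
  proof
    assume "nonzero_homology TYPE('k) K' n"
    then obtain z :: "'a set \<Rightarrow> 'k" where z: "chain K' n z" "bd z = 0"
      and nb: "\<nexists>b. chain K' (n + 1) b \<and> bd b = z"
      by (rule homologyE)
    obtain a b where z_eq: "z = a + wedge w b"
      and a: "chain (deletion w K') n a" and b: "chain (Lx \<union> Ly) (n - 1) b"
      using chain_split[OF K' z(1), of w] by (auto simp: lkw)
    obtain b1 b2 where b12: "b = b1 + b2" "chain Lx (n - 1) b1" "chain Ly (n - 1) b2"
      using chain_Un_split[OF b] by blast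
    have "(bd a + b) + wedge w (- bd b) = 0 + wedge w 0"
      using z(2) by (simp add: z_eq bd_w[OF b])
    from decomposition_unique[OF this] a b have cyc: "bd a + b = 0" "bd b = 0"
      by (auto intro: avs)
    \<comment> \<open>The halves \<open>b1\<close> and \<open>b2\<close> need not be cycles. Their
      boundaries cancel, hence lie in both \<open>Lx\<close> and \<open>Ly\<close>, and this common
      defect becomes the coefficient of the edge.\<close>
    define e where "e = - bd b1"
    have e2: "e = bd b2" using cyc(2) by (simp add: e_def b12 bd_add neg_eq_iff_add_eq_0)
    have e: "chain (Lx \<inter> Ly) (n - 1 - 1) e"
      using chain_minus[OF chain_bds(1)[OF b12(2)]] chain_bds(2)[OF b12(3)] e2
      by (intro chain_Int) (auto simp: e_def)
    have "bd e = 0" using bd_bd[OF cLy b12(3)] by (simp add: e2)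
    define c where "c = a + wedge x b1 + wedge y b2 + wedge x (wedge y e)"
    show "nonzero_homology TYPE('k) K n"
    proof (rule homologyI)
      show "chain K n c" unfolding c_def
        using b12 e by (intro chain_add wx wy wxy chain_weaken[OF a Dsub])
      show "bd c = 0" unfolding c_def bd_split[OF b12(2,3) e]
        using cyc(1) by (simp add: \<open>bd e = 0\<close> b12(1) add.assoc) (simp add: e_def e2[symmetric])
    next
      fix d assume d: "chain K (n + 1) d" "bd d = c"
      from split[OF d(1)] obtain \<alpha> \<beta> \<gamma> \<epsilon> where
        d_eq: "d = \<alpha> + wedge x \<beta> + wedge y \<gamma> + wedge x (wedge y \<epsilon>)"
        and ch: "chain (deletion w K') (n + 1) \<alpha>" "chain Lx n \<beta>" "chain Ly n \<gamma>"
          "chain (Lx \<inter> Ly) (n - 1) \<epsilon>" by auto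
      have "(bd \<alpha> + \<beta> + \<gamma>) + wedge x (- bd \<beta> - \<epsilon>) + wedge y (- bd \<gamma> + \<epsilon>)
          + wedge x (wedge y (bd \<epsilon>)) = a + wedge x b1 + wedge y b2 + wedge x (wedge y e)"
        using d(2) by (simp only: c_def d_eq bd_split[OF ch(2,3,4)])
      then have "bd \<alpha> + \<beta> + \<gamma> = a \<and> - bd \<beta> - \<epsilon> = b1 \<and> - bd \<gamma> + \<epsilon> = b2 \<and> bd \<epsilon> = e"
        by (rule unique) (simp_all add: avD[OF ch(1)] avD[OF a] avx[OF ch(2)] avx[OF b12(2)]
            avy[OF ch(3)] avy[OF b12(3)] avx[OF chain_Lxy(1)[OF ch(4)]] avx[OF chain_Lxy(1)[OF e]]
            avoids_add avoids_diff avoids_minus avoids_bd)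
      then have eqs: "bd \<alpha> + \<beta> + \<gamma> = a" "- bd \<beta> - \<epsilon> = b1" "- bd \<gamma> + \<epsilon> = b2"
        by simp_all
      \<comment> \<open>The edge coefficient \<open>\<epsilon>\<close> enters the two equations with
        opposite signs and cancels in the sum.\<close>
      have "- bd (\<beta> + \<gamma>) = b"
        by (simp add: b12(1) bd_add flip: eqs(2,3))
      moreover have bg: "chain (Lx \<union> Ly) n (\<beta> + \<gamma>)"
        using ch by (intro chain_add chain_LxLy) auto
      ultimately have "bd (\<alpha> + wedge w (\<beta> + \<gamma>)) = z"
        by (simp add: bd_w[OF bg] z_eq eqs(1) flip: add.assoc)
      moreover have "chain K' (n + 1) (\<alpha> + wedge w (\<beta> + \<gamma>))"
        using bg by (intro chain_add[OF chain_weaken[OF ch(1) deletion_subset] ww]) simp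
      ultimately show False using nb by blast
    qed
  next
    assume "nonzero_homology TYPE('k) K n"
    then obtain c :: "'a set \<Rightarrow> 'k" where c: "chain K n c" "bd c = 0"
      and nb: "\<nexists>b. chain K (n + 1) b \<and> bd b = c"
      by (rule homologyE)
    from split[OF c(1)] obtain a b1 b2 e where
      c_eq: "c = a + wedge x b1 + wedge y b2 + wedge x (wedge y e)"
      and ch: "chain (deletion w K') n a" "chain Lx (n - 1) b1" "chain Ly (n - 1) b2"
        "chain (Lx \<inter> Ly) (n - 1 - 1) e" by auto
    have "(bd a + b1 + b2) + wedge x (- bd b1 - e) + wedge y (- bd b2 + e)
        + wedge x (wedge y (bd e)) = 0 + wedge x 0 + wedge y 0 + wedge x (wedge y 0)"
      using c(2) by (simp add: c_eq bd_split[OF ch(2,3,4)])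
    then have "bd a + b1 + b2 = 0 \<and> - bd b1 - e = 0 \<and> - bd b2 + e = 0 \<and> bd e = 0"
      by (rule unique) (simp_all add: avD[OF ch(1)] avx[OF ch(2)] avy[OF ch(3)]
          avx[OF chain_Lxy(1)[OF ch(4)]]
          avoids_add avoids_diff avoids_minus avoids_bd avoids_zero)
    then have cyc: "bd a + b1 + b2 = 0" "- bd b1 - e = 0" "- bd b2 + e = 0"
      by simp_all
    have b: "chain (Lx \<union> Ly) (n - 1) (b1 + b2)" using ch by (intro chain_add chain_LxLy) auto
    have e1: "bd b1 = - e" using cyc(2) by (metis eq_iff_diff_eq_0 minus_minus)
    have e2: "bd b2 = e" using cyc(3) by (metis eq_iff_diff_eq_0 uminus_add_conv_diff)
    have bd_b: "bd (b1 + b2) = 0" by (simp add: bd_add e1 e2)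
    show "nonzero_homology TYPE('k) K' n"
    proof (rule homologyI)
      show "chain K' n (a + wedge w (b1 + b2))"
        using b by (intro chain_add[OF chain_weaken[OF ch(1) deletion_subset] ww])
      show "bd (a + wedge w (b1 + b2)) = 0"
        using cyc(1) bd_b by (simp add: bd_w[OF b] add.assoc)
    next
      fix d assume d: "chain K' (n + 1) d" "bd d = a + wedge w (b1 + b2)"
      obtain a' b' where d_eq: "d = a' + wedge w b'"
        and a': "chain (deletion w K') (n + 1) a'" and b': "chain (Lx \<union> Ly) n b'"
        using chain_split[OF K' d(1), of w] by (auto simp: lkw)
      have "(bd a' + b') + wedge w (- bd b') = a + wedge w (b1 + b2)"
        using d(2) by (simp add: d_eq bd_w[OF b'])
      from decomposition_unique[OF this] a' b' b ch(1)
      have ab: "bd a' + b' = a" "- bd b' = b1 + b2"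
        by (auto intro: avs)
      obtain p q where pq: "b' = p + q" "chain Lx n p" "chain Ly n q"
        using chain_Un_split[OF b'] by blast
      \<comment> \<open>The splitting of \<open>b'\<close> need not be compatible with
        \<open>b1\<close> and \<open>b2\<close>. The error \<open>\<beta>\<close> of the first half
        is minus that of the second, so it lies in \<open>Lx \<inter> Ly\<close> and can be
        corrected by an edge term.\<close>
      define \<beta> where "\<beta> = b1 + bd p"
      have "\<beta> + (b2 + bd q) = (b1 + b2) + bd b'"
        by (simp add: \<beta>_def pq(1) bd_add ac_simps)
      also have "\<dots> = 0" by (simp flip: ab(2))
      finally have \<beta>2: "\<beta> = - (b2 + bd q)" by (simp only: eq_neg_iff_add_eq_0)
      have "chain Lx (n - 1) \<beta>" "chain Ly (n - 1) \<beta>"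
        using chain_add[OF ch(2) chain_bds(1)[OF pq(2)]]
          chain_minus[OF chain_add[OF ch(3) chain_bds(2)[OF pq(3)]]]
        by (simp_all only: \<beta>_def[symmetric] \<beta>2[symmetric])
      then have \<beta>: "chain (Lx \<inter> Ly) (n - 1) \<beta>" by (rule chain_Int)
      have bd_\<beta>: "bd \<beta> = - e"
        using bd_bd[OF cLx pq(2)] by (simp add: \<beta>_def bd_add e1)
      let ?d = "a' + wedge x p + wedge y q + wedge x (wedge y (- \<beta>))"
      have \<beta>m: "chain (Lx \<inter> Ly) (n - 1) (- \<beta>)" using \<beta> by (rule chain_minus)
      have "bd ?d = (bd a' + p + q) + wedge x (- bd p - (- \<beta>)) + wedge y (- bd q + (- \<beta>))
          + wedge x (wedge y (bd (- \<beta>)))"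
        by (rule bd_split[OF pq(2,3) \<beta>m])
      moreover have "bd a' + p + q = a" using ab(1) pq(1) by (simp add: add.assoc)
      moreover have "- bd p - (- \<beta>) = b1" by (simp add: \<beta>_def)
      moreover have "- bd q + (- \<beta>) = b2" by (simp add: \<beta>2)
      moreover have "bd (- \<beta>) = e" by (simp add: bd_minus bd_\<beta>)
      ultimately have "bd ?d = c" by (simp add: c_eq)
      moreover have "chain K (n + 1) ?d"
        using pq \<beta>m by (intro chain_add wx wy wxy chain_weaken[OF a' Dsub]) simp_all
      ultimately show False using nb by blast
    qed
  qed
qed

section \<open>Independence complexes\<close>

text \<open>A face one larger than \<open>\<tau>\<close> is the same as a vertex to insert, which
  matches the two sums. For \<open>\<tau>\<close> outside \<open>K\<close> both sides vanish, since
  by closure under subsets no larger set is a face.\<close>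

lemma bdry_eq_bd:
  fixes c :: "'a set \<Rightarrow> 'k::field"
  assumes K: "simp_complex K" and c: "chain K n c"
  shows "bdry K c = bd c"
proof
  fix \<tau>
  let ?W = "{v \<in> V - \<tau>. insert v \<tau> \<in> K}"
  have outside: "c (insert v \<tau>) = 0" if "insert v \<tau> \<notin> K" for v
    using c that by (auto simp: chain_def)
  have bd: "bd c \<tau> = (\<Sum>v\<in>?W. sgn_at v \<tau> * c (insert v \<tau>))"
    unfolding bd_def using finite_V by (intro sum.mono_neutral_right) (use outside in auto)
  show "bdry K c \<tau> = bd c \<tau>"
  proof (cases "\<tau> \<in> K")
    case True
    then have fin: "finite \<tau>" by (rule simp_complex_finite[OF K])
    have bij: "bij_betw (\<lambda>v. insert v \<tau>) ?W {\<sigma> \<in> K. \<tau> \<subset> \<sigma> \<and> card \<sigma> = Suc (card \<tau>)}"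
    proof (rule bij_betw_imageI)
      show "inj_on (\<lambda>v. insert v \<tau>) ?W" by (rule inj_onI) blast
      show "(\<lambda>v. insert v \<tau>) ` ?W = {\<sigma> \<in> K. \<tau> \<subset> \<sigma> \<and> card \<sigma> = Suc (card \<tau>)}"
      proof (intro equalityI subsetI)
        fix \<sigma> assume "\<sigma> \<in> {\<sigma> \<in> K. \<tau> \<subset> \<sigma> \<and> card \<sigma> = Suc (card \<tau>)}"
        then have \<sigma>: "\<sigma> \<in> K" "\<tau> \<subset> \<sigma>" "card \<sigma> = Suc (card \<tau>)" by auto
        then have "card (\<sigma> - \<tau>) = 1" using fin by (simp add: card_Diff_subset psubset_imp_subset)
        then obtain v where "\<sigma> - \<tau> = {v}" by (rule card_1_singletonE)
        then have "\<sigma> = insert v \<tau>" "v \<notin> \<tau>" using \<sigma> by auto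
        moreover have "v \<in> V" using simp_complexD(1)[OF K \<sigma>(1)] calculation by auto
        ultimately show "\<sigma> \<in> (\<lambda>v. insert v \<tau>) ` ?W" using \<sigma> by auto
      qed (use fin in auto)
    qed
    have "bdry K c \<tau> = (\<Sum>v\<in>?W. (- 1) ^ card {u \<in> \<tau>. u < the_elem (insert v \<tau> - \<tau>)} * c (insert v \<tau>))"
      unfolding bdry_def using True by (simp add: sum.reindex_bij_betw[OF bij, symmetric])
    also have "\<dots> = bd c \<tau>"
      unfolding bd by (intro sum.cong) (auto simp: sgn_at_def insert_Diff_if)
    finally show ?thesis .
  next
    case False
    then have W: "?W = {}" using simp_complexD(2)[OF K] by blast
    show ?thesis unfolding bd W using False by (simp add: bdry_def)
  qed
qed

lemma redhom_nonzero_iff_homology: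
  assumes "simp_complex K"
  shows "redhom_nonzero T K j \<longleftrightarrow> nonzero_homology T K (int j)"
proof -
  have chain: "is_chain K m c \<longleftrightarrow> chain K (int m) c" for m and c :: "'a set \<Rightarrow> 'k::field"
    by (simp add: is_chain_def chain_def)
  have "bdry K c = bd c" if "is_chain K m c" for m and c :: "'a set \<Rightarrow> 'k::field"
    using bdry_eq_bd[OF assms] that chain by blast
  then show ?thesis
    unfolding redhom_nonzero_def nonzero_homology_def zero_fun_def[symmetric]
    by (smt (verit) chain of_nat_Suc add.commute)
qed

lemma simp_complex_Ind: "S \<subseteq> V \<Longrightarrow> simp_complex (Ind G S)"
  unfolding Ind_def indep_def by (rule simp_complexI) blast+

end

section \<open>Links of independence complexes and genuine pairs\<close>

lemma adj_commute: "adj G u v \<longleftrightarrow> adj G v u"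
  by (simp add: adj_def insert_commute)

lemma adj_verts:
  assumes "is_graph G" "adj G u v"
  shows "u \<in> verts G" "v \<in> verts G" "u \<noteq> v"
  using assms unfolding is_graph_def adj_def by (metis doubleton_eq_iff)+

lemma deletion_Ind: "deletion v (Ind G S) = Ind G (S - {v})"
  by (auto simp: deletion_def Ind_def)

lemma indep_insert:
  assumes "\<not> adj G v v"
  shows "indep G (insert v F) \<longleftrightarrow> indep G F \<and> (\<forall>u\<in>F. \<not> adj G v u)"
  unfolding indep_def using assms adj_commute by (metis insert_iff)

text \<open>Keeps every link within the class of independence complexes of induced subgraphs, so the
  exact sequences can be applied to vertex sets.\<close>

lemma link_Ind:
  assumes "is_graph G" "S \<subseteq> verts G" "v \<in> S"
  shows "link v (Ind G S) = Ind G (S - cnbhd G v)"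
proof -
  have "\<not> adj G v v" using adj_verts(3)[OF assms(1)] by blast
  moreover have "F \<subseteq> S - cnbhd G v \<longleftrightarrow> v \<notin> F \<and> F \<subseteq> S \<and> (\<forall>u\<in>F. \<not> adj G v u)" for F
    using assms(2) by (auto simp: cnbhd_def nbhd_def)
  ultimately show ?thesis
    using assms(3) by (auto simp: link_def Ind_def indep_insert)
qed

text \<open>Otherwise \<open>xp\<close> and \<open>yq\<close> would be the only edges among the four
  vertices, an induced \<open>2K_2\<close>. This is how genuineness enters the contraction
  argument.\<close>

lemma genuine_pair_adj:
  assumes G: "is_graph G" and xy: "genuine_pair G x y"
    and p: "p \<in> nbhd G x" "p \<notin> nbhd G y" and q: "q \<in> nbhd G y" "q \<notin> nbhd G x"
  shows "adj G p q"
proof (rule ccontr)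
  assume npq: "\<not> adj G p q"
  have V: "x \<in> verts G" "y \<in> verts G" "p \<in> verts G" "q \<in> verts G" "x \<noteq> y" "\<not> adj G x y"
    using xy p q by (auto simp: genuine_pair_def nbhd_def)
  have xp: "adj G x p" and yq: "adj G y q" and n: "\<not> adj G y p" "\<not> adj G x q"
    using p q by (auto simp: nbhd_def)
  have irr: "\<not> adj G z z" for z using adj_verts(3)[OF G] by blast
  have dist: "p \<noteq> x" "p \<noteq> y" "q \<noteq> x" "q \<noteq> y" "p \<noteq> q"
    using xp yq n V irr adj_commute[of G] by metis+
  have "e = {x, p} \<or> e = {y, q}" if e: "e \<in> edges G" "e \<subseteq> {x, y, p, q}" for e
  proof -
    obtain s t where st: "e = {s, t}" "s \<noteq> t" using G e(1) unfolding is_graph_def by metis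
    then have "adj G s t" using e(1) by (simp add: adj_def)
    moreover have "s \<in> {x, y, p, q}" "t \<in> {x, y, p, q}" using e(2) st by auto
    ultimately show ?thesis
      using st npq n V(6) adj_commute[of G] by (auto simp: insert_commute)
  qed
  then have "{e \<in> edges G. e \<subseteq> {x, y, p, q}} = {{x, p}, {y, q}}"
    using xp yq by (auto simp: adj_def)
  moreover have "{x, y, p, q} = {x, p, y, q}" "card {x, y, p, q} = 4"
    using dist V(5) by auto
  ultimately have "induces_2K2 G {x, y, p, q}"
    unfolding induces_2K2_def using V by blast
  then show False using xy V dist unfolding genuine_pair_def by blast
qed

section \<open>The graph g(G;xy)\<close>

lemma verts_gpair: "verts (gpair G x y w) = insert w (verts G - {x, y})"
  by (simp add: gpair_def verts_def)

text \<open>The name \<open>w\<close> may be fresh or may reuse \<open>x\<close> or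
  \<open>y\<close>; in each case it differs from all remaining vertices, so the new edges are not
  loops.\<close>

lemma is_graph_gpair:
  assumes G: "is_graph G" and w: "w \<notin> verts G - {x, y}"
  shows "is_graph (gpair G x y w)"
  unfolding is_graph_def
proof (intro conjI ballI)
  show "finite (verts (gpair G x y w))" using G by (simp add: verts_gpair is_graph_def)
next
  fix e assume "e \<in> edges (gpair G x y w)"
  then consider "e \<in> edges G" "x \<notin> e" "y \<notin> e" | u where "e = {w, u}" "u \<in> nbhd G x \<inter> nbhd G y"
    by (auto simp: gpair_def edges_def)
  then show "\<exists>u v. e = {u, v} \<and> u \<noteq> v \<and> u \<in> verts (gpair G x y w) \<and> v \<in> verts (gpair G x y w)"
  proof cases
    case 1
    then obtain u v where "e = {u, v}" "u \<noteq> v" "u \<in> verts G" "v \<in> verts G"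
      using G unfolding is_graph_def by metis
    then show ?thesis using 1 by (intro exI[of _ u] exI[of _ v]) (auto simp: verts_gpair)
  next
    case 2
    then have "u \<in> verts G - {x, y}" using adj_verts(3)[OF G] by (auto simp: nbhd_def)
    then show ?thesis using 2 w by (intro exI[of _ w] exI[of _ u]) (auto simp: verts_gpair)
  qed
qed

lemma adj_gpair:
  assumes "w \<notin> verts G - {x, y}" "u \<in> verts G - {x, y}" "v \<in> verts G - {x, y}"
  shows "adj (gpair G x y w) u v \<longleftrightarrow> adj G u v"
  using assms by (auto simp: adj_def gpair_def edges_def doubleton_eq_iff)

text \<open>No old edge at \<open>w\<close> survives: either \<open>w\<close> is no vertex of
  \<open>G\<close>, or it is \<open>x\<close> or \<open>y\<close>, whose edges are removed.\<close>

lemma adj_gpair_new: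
  assumes "is_graph G" "w \<notin> verts G - {x, y}" "u \<in> verts G - {x, y}"
  shows "adj (gpair G x y w) w u \<longleftrightarrow> u \<in> nbhd G x \<inter> nbhd G y"
  using assms adj_verts(1)[OF assms(1), of w u]
  by (auto simp: adj_def gpair_def edges_def doubleton_eq_iff)

lemma Ind_gpair:
  assumes "w \<notin> verts G - {x, y}" "S \<subseteq> verts G - {x, y}"
  shows "Ind (gpair G x y w) S = Ind G S"
proof -
  have "indep (gpair G x y w) F \<longleftrightarrow> indep G F" if "F \<subseteq> S" for F
    using that assms adj_gpair[OF assms(1)] unfolding indep_def by (meson subsetD)
  then show ?thesis by (auto simp: Ind_def)
qed

section \<open>Homology of G compared with that of g(G;xy)\<close>

context vertex_set
begin

lemma homology_gpair_new:
  assumes G: "is_graph G" "verts G \<subseteq> V" and xy: "genuine_pair G x y"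
    and w: "w \<notin> verts G - {x, y}" "w \<in> V" and S: "S \<subseteq> verts G - {x, y}"
  shows "nonzero_homology TYPE('k::field) (Ind (gpair G x y w) (insert w S)) n
    \<longleftrightarrow> nonzero_homology TYPE('k) (Ind G (insert x (insert y S))) n"
proof (rule homology_edge_contraction)
  let ?G' = "gpair G x y w" and ?K = "Ind G (insert x (insert y S))"
  have V: "x \<in> verts G" "y \<in> verts G" "x \<noteq> y" "\<not> adj G x y" "\<not> adj G y x"
    using xy adj_commute[of G x y] by (auto simp: genuine_pair_def)
  then show "x \<in> V" "y \<in> V" "w \<in> V" "x \<noteq> y" using G w by auto
  show "simp_complex ?K" "simp_complex (Ind ?G' (insert w S))"
    using G w S V by (auto intro!: simp_complex_Ind)
  note G' = is_graph_gpair[OF G(1) w(1)]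
  have "w \<notin> S" using w S by auto
  then show "deletion w (Ind ?G' (insert w S)) = deletion y (deletion x ?K)"
    using S V Ind_gpair[OF w(1) S] by (auto simp: deletion_Ind intro!: arg_cong[of _ _ "Ind G"])
  have x: "link x ?K = Ind G (insert y (S - nbhd G x))"
    using S V by (subst link_Ind[OF G(1)])
      (auto simp: cnbhd_def nbhd_def intro!: arg_cong[of _ _ "Ind G"])
  have y: "link y ?K = Ind G (insert x (S - nbhd G y))"
    using S V by (subst link_Ind[OF G(1)])
      (auto simp: cnbhd_def nbhd_def intro!: arg_cong[of _ _ "Ind G"])
  have dx: "deletion y (link x ?K) = Ind G (S - nbhd G x)"
    using S by (auto simp: x deletion_Ind intro!: arg_cong[of _ _ "Ind G"])
  have dy: "deletion x (link y ?K) = Ind G (S - nbhd G y)"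
    using S by (auto simp: y deletion_Ind intro!: arg_cong[of _ _ "Ind G"])
  have "link w (Ind ?G' (insert w S)) = Ind ?G' (insert w S - cnbhd ?G' w)"
    using S by (intro link_Ind[OF G']) (auto simp: verts_gpair)
  also have "insert w S - cnbhd ?G' w = S - nbhd G x \<inter> nbhd G y"
    using S \<open>w \<notin> S\<close> adj_gpair_new[OF G(1) w(1)]
    by (auto simp: cnbhd_def nbhd_def[of ?G'] verts_gpair)
  also have "Ind ?G' (S - nbhd G x \<inter> nbhd G y) = Ind G (S - nbhd G x \<inter> nbhd G y)"
    using S by (intro Ind_gpair[OF w(1)]) auto
  \<comment> \<open>Missing all common neighbours must imply missing \<open>N(x)\<close> or
    \<open>N(y)\<close> entirely: vertices of an independent set in the two private neighbourhoods
    would be adjacent by genuineness.\<close>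
  also have "\<dots> = Ind G (S - nbhd G x) \<union> Ind G (S - nbhd G y)"
  proof (intro equalityI subsetI)
    fix F assume "F \<in> Ind G (S - nbhd G x \<inter> nbhd G y)"
    then have F: "F \<subseteq> S" "F \<inter> (nbhd G x \<inter> nbhd G y) = {}" "indep G F" by (auto simp: Ind_def)
    have "F \<inter> nbhd G x = {} \<or> F \<inter> nbhd G y = {}"
    proof (rule ccontr)
      assume "\<not> ?thesis"
      then obtain p q where "p \<in> F" "p \<in> nbhd G x" "q \<in> F" "q \<in> nbhd G y" by blast
      moreover from this have "adj G p q"
        using F(2) by (intro genuine_pair_adj[OF G(1) xy]) auto
      ultimately show False using F(3) by (auto simp: indep_def)
    qed
    then show "F \<in> Ind G (S - nbhd G x) \<union> Ind G (S - nbhd G y)"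
      using F by (auto simp: Ind_def)
  qed (auto simp: Ind_def)
  finally show "link w (Ind ?G' (insert w S)) = deletion y (link x ?K) \<union> deletion x (link y ?K)"
    by (simp only: dx dy)
  have "link y (link x ?K) = Ind G (insert y (S - nbhd G x) - cnbhd G y)"
    unfolding x using S V by (intro link_Ind[OF G(1)]) auto
  also have "insert y (S - nbhd G x) - cnbhd G y = S - nbhd G x - nbhd G y"
    using S by (auto simp: cnbhd_def)
  also have "Ind G (S - nbhd G x - nbhd G y) = Ind G (S - nbhd G x) \<inter> Ind G (S - nbhd G y)"
    by (auto simp: Ind_def)
  finally show "link y (link x ?K) = deletion y (link x ?K) \<inter> deletion x (link y ?K)"
    by (simp only: dx dy)
qed

text \<open>The two exact sequences are applied in turn: first \<open>y\<close> is added to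
  \<open>S\<close>, then \<open>x\<close> is removed from the link of \<open>y\<close>. Any two
  distinct non-adjacent vertices are allowed, so the roles of \<open>x\<close> and \<open>y\<close>
  can be exchanged.\<close>

lemma homology_Ind_one_endpoint:
  assumes G: "is_graph G" "verts G \<subseteq> V"
    and xy: "x \<in> verts G" "y \<in> verts G" "x \<noteq> y" "\<not> adj G x y"
    and S: "S \<subseteq> verts G" "x \<in> S" "y \<notin> S"
    and nz: "nonzero_homology TYPE('k::field) (Ind G S) n"
  obtains "nonzero_homology TYPE('k) (Ind G (insert y S)) n"
  | T where "T \<subseteq> verts G - {x, y}" "nonzero_homology TYPE('k) (Ind G T) n"
  | T where "T \<subseteq> verts G - (cnbhd G x \<union> cnbhd G y)" "nonzero_homology TYPE('k) (Ind G T) (n - 1)"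
proof -
  have yx: "\<not> adj G y x" using xy(4) adj_commute[of G x y] by simp
  let ?T = "S - cnbhd G y"
  have yS: "insert y S \<subseteq> verts G" using S xy by auto
  have T: "link y (Ind G (insert y S)) = Ind G ?T"
    by (subst link_Ind[OF G(1) yS]) (auto simp: cnbhd_def)
  have "deletion y (Ind G (insert y S)) = Ind G S" using S by (simp add: deletion_Ind)
  then have "nonzero_homology TYPE('k) (Ind G (insert y S)) n \<or> nonzero_homology TYPE('k) (Ind G ?T) n"
    using homology_from_deletion[of "Ind G (insert y S)" y, where 'k = 'k and n = n]
      simp_complex_Ind[of "insert y S" G] nz yS G xy T by auto
  then show ?thesis
  proof
    assume nzT: "nonzero_homology TYPE('k) (Ind G ?T) n"
    \<comment> \<open>Non-adjacency keeps \<open>x\<close> outside the closed neighbourhood of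
      \<open>y\<close>.\<close>
    have xT: "x \<in> ?T" "?T \<subseteq> verts G" using S xy yx by (auto simp: cnbhd_def nbhd_def)
    have lk: "link x (Ind G ?T) = Ind G (?T - cnbhd G x)"
      by (rule link_Ind[OF G(1) xT(2,1)])
    have "nonzero_homology TYPE('k) (Ind G (?T - {x})) n \<or>
        nonzero_homology TYPE('k) (Ind G (?T - cnbhd G x)) (n - 1)"
      using homology_into_deletion[of "Ind G ?T" x, where 'k = 'k and n = n]
        simp_complex_Ind[of ?T G] nzT xT G lk by (auto simp: deletion_Ind)
    then show ?thesis
      using that(2)[of "?T - {x}"] that(3)[of "?T - cnbhd G x"] S by auto
  qed (rule that(1))
qed

text \<open>Neither \<open>w\<close> nor \<open>u\<close> has a neighbour in \<open>T\<close>, and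
  they are adjacent to each other, so each is excluded from the link of the other. Both links equal
  \<open>Ind G T\<close>, and the suspension raises the degree.\<close>

lemma homology_gpair_suspension:
  assumes G: "is_graph G" "verts G \<subseteq> V" and w: "w \<notin> verts G - {x, y}" "w \<in> V"
    and u: "u \<in> nbhd G x \<inter> nbhd G y" "cnbhd G u \<subseteq> cnbhd G x \<union> cnbhd G y"
    and T: "T \<subseteq> verts G - (cnbhd G x \<union> cnbhd G y)"
    and nz: "nonzero_homology TYPE('k::field) (Ind G T) n"
  shows "nonzero_homology TYPE('k) (Ind (gpair G x y w) (insert w (insert u T))) (n + 1)"
proof -
  let ?G' = "gpair G x y w" and ?S = "insert w (insert u T)"
  note G' = is_graph_gpair[OF G(1) w(1)]
  have uV: "u \<in> verts G - {x, y}" using u adj_verts(3)[OF G(1)] by (auto simp: nbhd_def)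
  have TV: "T \<subseteq> verts G - {x, y}" using T by (auto simp: cnbhd_def)
  have uT: "u \<notin> T" using T u by (auto simp: cnbhd_def)
  have wuT: "w \<noteq> u" "w \<notin> T" using w uV TV by auto
  have S: "?S \<subseteq> verts ?G'" using uV TV by (auto simp: verts_gpair)
  have wu: "adj ?G' w u" using adj_gpair_new[OF G(1) w(1) uV] u by simp
  have wt: "\<not> adj ?G' w t" if "t \<in> T" for t
    using adj_gpair_new[OF G(1) w(1), of t] that TV T by (auto simp: cnbhd_def)
  \<comment> \<open>Trueness is used here: a neighbour of \<open>u\<close> in \<open>T\<close> would
    lie in one of the closed neighbourhoods that \<open>T\<close> avoids.\<close>
  have ut: "\<not> adj ?G' u t" if "t \<in> T" for t
    using adj_gpair[OF w(1) uV, of t] that TV T u(2) by (auto simp: cnbhd_def nbhd_def)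
  have "?S - cnbhd ?G' w = T"
    using wu wt uT wuT uV by (auto simp: cnbhd_def nbhd_def verts_gpair)
  then have lw: "link w (Ind ?G' ?S) = Ind G T"
    using link_Ind[OF G' S, of w] Ind_gpair[OF w(1) TV] by simp
  have "?S - cnbhd ?G' u = T"
    using wu ut uT wuT adj_commute[of ?G' w u] by (auto simp: cnbhd_def nbhd_def verts_gpair)
  then have lu: "link u (Ind ?G' ?S) = Ind G T"
    using link_Ind[OF G' S, of u] Ind_gpair[OF w(1) TV] by simp
  have "simp_complex (Ind ?G' ?S)"
    using uV TV G w by (intro simp_complex_Ind) auto
  moreover have "link w (Ind ?G' ?S) \<subseteq> link u (Ind ?G' ?S)" by (simp only: lw lu)
  moreover have "nonzero_homology TYPE('k) (link w (Ind ?G' ?S)) n" using nz by (simp only: lw)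
  ultimately show ?thesis
    using w(2) uV G(2) wuT(1) by (intro homology_suspension[of "Ind ?G' ?S" w u]) auto
qed

end

theorem mainTheorem16:
  fixes G :: "'a::linorder graph" and x y w :: 'a
  assumes "is_graph G"
    and "true_pair G x y"
    and "w \<notin> verts G - {x, y}"
  shows "reg TYPE('k::field) G = reg TYPE('k) (gpair G x y w)"
proof -
  let ?G' = "gpair G x y w"
  \<comment> \<open>One ambient vertex set for both graphs.\<close>
  define V where "V = insert w (verts G)"
  interpret vertex_set V
    using assms(1) by unfold_locales (simp add: V_def is_graph_def)
  have GV: "verts G \<subseteq> V" "w \<in> V" by (auto simp: V_def)
  have xy: "genuine_pair G x y" using assms(2) by (simp add: true_pair_def)
  then have V: "x \<in> verts G" "y \<in> verts G" "x \<noteq> y" "\<not> adj G x y" "\<not> adj G y x"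
    using adj_commute[of G x y] by (auto simp: genuine_pair_def)
  obtain u where u: "u \<in> nbhd G x \<inter> nbhd G y" "cnbhd G u \<subseteq> cnbhd G x \<union> cnbhd G y"
    using assms(2) unfolding true_pair_def by blast
  have uV: "u \<in> verts G - {x, y}" using u adj_verts(3)[OF assms(1)] by (auto simp: nbhd_def)
  note new = homology_gpair_new[OF assms(1) GV(1) xy assms(3) GV(2), where 'k = 'k]
  note old = Ind_gpair[OF assms(3)]
  have "(\<exists>S\<subseteq>verts G. nonzero_homology TYPE('k) (Ind G S) n)
      \<longleftrightarrow> (\<exists>S\<subseteq>verts ?G'. nonzero_homology TYPE('k) (Ind ?G' S) n)" (is "?L \<longleftrightarrow> ?R") for n
  proof
    have both: ?R if "S \<subseteq> verts G - {x, y}" "nonzero_homology TYPE('k) (Ind G (insert x (insert y S))) n" for S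
      using new[of S n] that by (intro exI[of _ "insert w S"]) (auto simp: verts_gpair)
    have none: ?R if "S \<subseteq> verts G - {x, y}" "nonzero_homology TYPE('k) (Ind G S) n" for S
      using old[of S] that by (intro exI[of _ S]) (auto simp: verts_gpair)
    have susp: ?R if T: "T \<subseteq> verts G - (cnbhd G x \<union> cnbhd G y)"
      and nz: "nonzero_homology TYPE('k) (Ind G T) (n - 1)" for T
    proof (intro exI[of _ "insert w (insert u T)"] conjI)
      show "insert w (insert u T) \<subseteq> verts ?G'"
        using T uV by (auto simp: verts_gpair cnbhd_def)
      show "nonzero_homology TYPE('k) (Ind ?G' (insert w (insert u T))) n"
        using homology_gpair_suspension[OF assms(1) GV(1) assms(3) GV(2) u T nz] by simp
    qed
    assume ?L
    then obtain S where S: "S \<subseteq> verts G" "nonzero_homology TYPE('k) (Ind G S) n" by blast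
    consider "x \<in> S" "y \<in> S" | "x \<notin> S" "y \<notin> S" | "x \<in> S" "y \<notin> S" | "x \<notin> S" "y \<in> S" by blast
    then show ?R
    proof cases
      case 1
      then have "insert x (insert y (S - {x, y})) = S" by auto
      then show ?thesis using both[of "S - {x, y}"] S by auto
    next
      case 2
      then show ?thesis using none[of S] S by auto
    next
      case 3
      \<comment> \<open>With both endpoints restored, \<open>S - {x, y}\<close> becomes
        \<open>insert y S\<close>, to which the contraction applies.\<close>
      then have eq: "insert x (insert y (S - {x, y})) = insert y S" by auto
      show ?thesis
      proof (rule homology_Ind_one_endpoint[OF assms(1) GV(1) V(1-4) S(1) 3 S(2)])
        show ?R if "nonzero_homology TYPE('k) (Ind G (insert y S)) n"
          using both[of "S - {x, y}"] that S(1) by (auto simp: eq)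
      qed (rule none susp; assumption)+
    next
      case 4
      then have eq: "insert x (insert y (S - {x, y})) = insert x S" by auto
      show ?thesis
      proof (rule homology_Ind_one_endpoint[OF assms(1) GV(1) V(2,1) V(3)[symmetric] V(5) S(1)
            4(2,1) S(2)])
        show ?R if "nonzero_homology TYPE('k) (Ind G (insert x S)) n"
          using both[of "S - {x, y}"] that S(1) by (auto simp: eq)
        show ?R if "T \<subseteq> verts G - {y, x}" "nonzero_homology TYPE('k) (Ind G T) n" for T
          using none[of T] that by (simp add: insert_commute)
        show ?R if "T \<subseteq> verts G - (cnbhd G y \<union> cnbhd G x)"
          "nonzero_homology TYPE('k) (Ind G T) (n - 1)" for T
          using susp[of T] that by (simp add: Un_commute)
      qed
    qed
  next
    assume ?R
    then obtain S where S: "S \<subseteq> verts ?G'" "nonzero_homology TYPE('k) (Ind ?G' S) n" by blast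
    show ?L
    proof (cases "w \<in> S")
      case True
      \<comment> \<open>Sets with \<open>w\<close> come from contracting the edge \<open>xy\<close>;
        sets without \<open>w\<close> induce the same subgraph in both graphs.\<close>
      then have "insert w (S - {w}) = S" "S - {w} \<subseteq> verts G - {x, y}"
        using S by (auto simp: verts_gpair)
      then show ?thesis using new[of "S - {w}" n] S V
        by (intro exI[of _ "insert x (insert y (S - {w}))"]) auto
    next
      case False
      then have "S \<subseteq> verts G - {x, y}" using S by (auto simp: verts_gpair)
      then show ?thesis using old[of S] S by (intro exI[of _ S]) auto
    qed
  qed
  moreover have "redhom_nonzero TYPE('k) (Ind G S) j \<longleftrightarrow> nonzero_homology TYPE('k) (Ind G S) (int j)"
    if "S \<subseteq> verts G" for S j
    using that GV by (intro redhom_nonzero_iff_homology simp_complex_Ind) auto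
  moreover have "redhom_nonzero TYPE('k) (Ind ?G' S) j \<longleftrightarrow> nonzero_homology TYPE('k) (Ind ?G' S) (int j)"
    if "S \<subseteq> verts ?G'" for S j
    using that GV by (intro redhom_nonzero_iff_homology simp_complex_Ind) (auto simp: verts_gpair)
  \<comment> \<open>The equivalence holds in every integer degree; specialised to
    \<open>int j\<close>, it equates the sets whose maxima are the two regularities.\<close>
  ultimately have "{j. \<exists>S\<subseteq>verts G. redhom_nonzero TYPE('k) (Ind G S) j}
      = {j. \<exists>S\<subseteq>verts ?G'. redhom_nonzero TYPE('k) (Ind ?G' S) j}"
    by (metis (no_types, lifting))
  then show ?thesis by (simp only: reg_def)
qed

end
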